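(* Let $\mathcal G$ be the 3-player anti-correlation game. Then there exists a constant $c>0$ such that for every $n\in\mathbb N$, $\mathrm{val}(\mathcal G^{\otimes n})\le \exp(-c n)$.
   Context: The anti-correlation game is the 3-player game with question sets and answer sets all equal to $\{0,1\}$, question distribution $Q$ uniform on $\{(0,1,1),(1,0,1),(1,1,0)\}$, and predicate $V((x,y,z),(a,b,c))=1$ iff $xa+yb+zc=1$ (i.e., the two players receiving $1$ must output different bits). For a $k$-player game with finite question set $\mathcal X=\prod_j\mathcal X^j$, answer set $\mathcal A=\prod_j\mathcal A^j$, distribution $Q$ and predicate $V$, the value is the maximum over deterministic strategies $f^j:\mathcal X^j\to\mathcal A^j$ of the probability that $V(x,(f^j(x^j))_j)=1$ for $x\sim Q$. The $n$-fold parallel repetition $\mathcal G^{\otimes n}$ draws $n$ i.i.d. question tuples from $Q$, player $j$ receives its $n$ questions and outputs $n$ answers, and the players win iff $V$ holds in every coordinate. *)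

theory Defs
  imports "HOL-Probability.Probability"
begin

text \<open>
  A multiplayer game: players are the elements of the (finite) type \<open>'p\<close>, so that a
  \<open>k\<close>-player game is one with \<open>CARD('p) = k\<close>.  A question tuple (or answer tuple) is a
  function assigning to each player her own question (answer); the question sets and answer sets
  may differ between players.
\<close>

record ('p, 'q, 'a) game =
  questions :: "'p \<Rightarrow> 'q set"
  answers :: "'p \<Rightarrow> 'a set"
  distr :: "('p \<Rightarrow> 'q) pmf"
  pred :: "('p \<Rightarrow> 'q) \<Rightarrow> ('p \<Rightarrow> 'a) \<Rightarrow> bool"

definition wf_game :: "('p::finite, 'q, 'a) game \<Rightarrow> bool" where
  "wf_game G \<longleftrightarrow>
     (\<forall>j. finite (questions G j)) \<and> (\<forall>j. finite (answers G j) \<and> answers G j \<noteq> {}) \<and>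
     set_pmf (distr G) \<subseteq> (\<Pi> j\<in>UNIV. questions G j)"

text \<open>
  Strategies are extensional functions on the question sets, so that for a well-formed game there
  are finitely many of them and the maximum in the value is a genuine one.
\<close>

definition strategies :: "('p::finite, 'q, 'a) game \<Rightarrow> ('p \<Rightarrow> 'q \<Rightarrow> 'a) set" where
  "strategies G = (\<Pi>\<^sub>E j\<in>UNIV. questions G j \<rightarrow>\<^sub>E answers G j)"

definition win_prob :: "('p::finite, 'q, 'a) game \<Rightarrow> ('p \<Rightarrow> 'q \<Rightarrow> 'a) \<Rightarrow> real" where
  "win_prob G f = measure_pmf.prob (distr G) {x. pred G x (\<lambda>j. f j (x j))}"

definition val :: "('p::finite, 'q, 'a) game \<Rightarrow> real" where
  "val G = Max (win_prob G ` strategies G)"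

text \<open>
  \<open>replicate_pmf n Q\<close> is the list of \<open>n\<close> i.i.d. samples from \<open>Q\<close>; player \<open>j\<close> receives the list
  of the \<open>j\<close>-th components of these samples.
\<close>

definition parallel_repetition ::
    "nat \<Rightarrow> ('p::finite, 'q, 'a) game \<Rightarrow> ('p, 'q list, 'a list) game" where
  "parallel_repetition n G =
     \<lparr> questions = (\<lambda>j. {xs. set xs \<subseteq> questions G j \<and> length xs = n}),
       answers = (\<lambda>j. {as. set as \<subseteq> answers G j \<and> length as = n}),
       distr = map_pmf (\<lambda>qs j. map (\<lambda>q. q j) qs) (replicate_pmf n (distr G)),
       pred = (\<lambda>x a. \<forall>i<n. pred G (\<lambda>j. x j ! i) (\<lambda>j. a j ! i)) \<rparr>"

lemma strategies_finite_nonempty: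
  assumes "wf_game G"
  shows "finite (strategies G)" and "strategies G \<noteq> {}"
  using assms unfolding strategies_def wf_game_def
  by (auto intro!: finite_PiE simp: PiE_eq_empty_iff)

lemma wf_game_parallel_repetition:
  assumes "wf_game G"
  shows "wf_game (parallel_repetition n G)"
proof -
  have "{as. set as \<subseteq> A \<and> length as = n} \<noteq> {}" if "A \<noteq> {}" for A :: "'c set"
  proof -
    from that obtain a where "a \<in> A" by blast
    then have "replicate n a \<in> {as. set as \<subseteq> A \<and> length as = n}" by auto
    then show ?thesis by blast
  qed
  then show ?thesis
    using assms unfolding wf_game_def parallel_repetition_def
    by (force simp: finite_lists_length_eq set_replicate_pmf Pi_iff lists_eq_set)
qed

datatype player = P1 | P2 | P3

instance player :: finite
proof
  have "(UNIV :: player set) = {P1, P2, P3}"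
    using player.exhaust by blast
  then show "finite (UNIV :: player set)"
    by (metis finite.emptyI finite.insertI)
qed

text \<open>
  \<open>case_player u v w\<close> is the tuple \<open>(u, v, w)\<close>.  The sum in the predicate is a sum of natural
  numbers, not a sum modulo 2; on the support of the distribution exactly two questions equal 1,
  so the two readings would agree there.
\<close>

definition anti_correlation :: "(player, nat, nat) game" where
  "anti_correlation =
     \<lparr> questions = (\<lambda>_. {0, 1}),
       answers = (\<lambda>_. {0, 1}),
       distr = pmf_of_set {case_player 0 1 1, case_player 1 0 1, case_player 1 1 0},
       pred = (\<lambda>x a. x P1 * a P1 + x P2 * a P2 + x P3 * a P3 = 1) \<rparr>"

lemma wf_game_anti_correlation: "wf_game anti_correlation"
  unfolding wf_game_def anti_correlation_def
  by (auto simp: set_pmf_of_set split: player.splits)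

end

theory Submission
  imports Defs
begin

text \<open>
  A question tuple is determined by the player receiving 0, so \<open>n\<close> question tuples form a word over
  the players.  Take a pair of winning words that agree on the positions of \<open>P1\<close>, and two
  resamplings of this pair, each preserving the question lists of some of the players.  By a
  Cauchy--Schwarz type bound all six words win with probability polynomial in the winning
  probability.  On the other hand, in each coordinate there is a configuration of probability
  bounded below that would make five answer bits alternate around a cycle of length 5, so winning
  forbids it; since the sampling is a product measure, its avoidance in all coordinates is
  exponentially unlikely.
\<close>

section \<open>Fibre densities and the resampling inequality\<close>

lemma three_le_if_prod_eq_one:
  fixes x y z :: real
  assumes "x > 0" "y > 0" "z > 0" "x * y * z = 1"
  shows "3 \<le> x + y + z"
proof -
  define f where "f = (\<lambda>i::nat. if i = 0 then x else if i = 1 then y else z)"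
  have "(\<Prod>i\<in>{..<3}. f i) powr (1 / card {..<3::nat}) \<le> (\<Sum>i\<in>{..<3}. f i / card {..<3::nat})"
    by (rule arith_geom_mean) (use assms in \<open>auto simp: f_def lessThan_empty_iff\<close>)
  moreover have "(\<Prod>i\<in>{..<3}. f i) = 1"
    using assms(4) by (simp add: f_def numeral_3_eq_3 mult.assoc)
  moreover have "(\<Sum>i\<in>{..<3}. f i / card {..<3::nat}) = (x + y + z) / 3"
    by (simp add: f_def numeral_3_eq_3 field_simps)
  ultimately show ?thesis by simp
qed

text \<open>For \<open>U\<close> contained in \<open>X\<close>, this is the conditional probability
  that a uniform point of \<open>X\<close> lies in \<open>U\<close>, given that its value under
  \<open>p\<close> is \<open>p x\<close>.\<close>

definition fibre_density :: "('x \<Rightarrow> 'y) \<Rightarrow> 'x set \<Rightarrow> 'x set \<Rightarrow> 'x \<Rightarrow> real" where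
  "fibre_density p X U x = card {y \<in> U. p y = p x} / card {y \<in> X. p y = p x}"

lemma fibre_density_pos:
  assumes "finite X" "U \<subseteq> X" "x \<in> U"
  shows "fibre_density p X U x > 0"
proof -
  have "x \<in> {y \<in> U. p y = p x}" "x \<in> {y \<in> X. p y = p x}" using assms by auto
  moreover have "finite {y \<in> U. p y = p x}" "finite {y \<in> X. p y = p x}"
    using assms by (auto intro: finite_subset)
  ultimately have "card {y \<in> U. p y = p x} > 0" "card {y \<in> X. p y = p x} > 0"
    using card_gt_0_iff by blast+
  then show ?thesis by (simp add: fibre_density_def)
qed

text \<open>On a fibre of \<open>p\<close> that meets \<open>U\<close> the summand is constant, and
  the number of summands cancels its denominator, leaving the size of the fibre in \<open>X\<close>.
  Fibres that miss \<open>U\<close> contribute nothing, whence only an inequality.\<close>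

lemma sum_inverse_fibre_density_le:
  assumes "finite X" "U \<subseteq> X"
  shows "(\<Sum>x\<in>U. 1 / fibre_density p X U x) \<le> card X"
proof -
  have fU: "finite U" using assms finite_subset by blast
  have inner: "(\<Sum>x\<in>{x \<in> U. p x = y}. 1 / fibre_density p X U x) = card {x \<in> X. p x = y}"
    if "y \<in> p ` U" for y
  proof -
    have "(\<Sum>x\<in>{x \<in> U. p x = y}. 1 / fibre_density p X U x)
        = (\<Sum>x\<in>{x \<in> U. p x = y}. card {x \<in> X. p x = y} / card {x \<in> U. p x = y})"
      by (intro sum.cong) (auto simp: fibre_density_def)
    moreover have "card {x \<in> U. p x = y} \<noteq> 0"
      using that fU by (auto simp: card_eq_0_iff)
    ultimately show ?thesis by simp
  qed
  have "(\<Sum>x\<in>U. 1 / fibre_density p X U x)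
      = (\<Sum>y\<in>p ` U. \<Sum>x\<in>{x \<in> U. p x = y}. 1 / fibre_density p X U x)"
    by (rule sum.image_gen[OF fU])
  also have "\<dots> = (\<Sum>y\<in>p ` U. real (card {x \<in> X. p x = y}))"
    by (intro sum.cong refl inner)
  also have "\<dots> \<le> (\<Sum>y\<in>p ` X. real (card {x \<in> X. p x = y}))"
    using assms by (intro sum_mono2) auto
  also have "\<dots> = card X"
    using sum.image_gen[OF assms(1), of "\<lambda>_. 1::real" p] by simp
  finally show ?thesis .
qed

text \<open>
  The left-hand side, divided by \<open>card X\<close>, is the probability that a uniform \<open>x\<close> in \<open>X\<close> and two
  resamplings of it, one conditioned on \<open>p x\<close> and one on \<open>q x\<close>, all three lie in \<open>U\<close>.
\<close>

lemma reflection_bound: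
  assumes "finite X" "X \<noteq> {}" "U \<subseteq> X"
  shows "(\<Sum>x\<in>U. fibre_density p X U x * fibre_density q X U x)
       \<ge> (card U / card X) ^ 3 * card X"
proof (cases "U = {}")
  case False
  have fU: "finite U" using assms finite_subset by blast
  define N where "N = real (card X)"
  define r where "r = card U / N"
  have N: "N > 0" using assms by (simp add: N_def card_gt_0_iff)
  have r: "r > 0" using N False fU by (simp add: r_def card_gt_0_iff)
  let ?E = "\<Sum>x\<in>U. fibre_density p X U x * fibre_density q X U x"
  \<comment> \<open>The powers of \<open>r\<close> make the three terms have product 1, with
    equality in AM-GM when both densities equal \<open>r\<close>. The last two terms sum to at most
    \<open>r * N\<close> each, and the left side is \<open>3 * r * N\<close>, so
    \<open>r * N\<close> remains for the first.\<close>
  have "(\<Sum>x\<in>U. 3) \<le> (\<Sum>x\<in>U. fibre_density p X U x * fibre_density q X U x / r\<^sup>2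
        + r * (1 / fibre_density p X U x) + r * (1 / fibre_density q X U x))"
  proof (rule sum_mono)
    fix x assume "x \<in> U"
    then show "3 \<le> fibre_density p X U x * fibre_density q X U x / r\<^sup>2
        + r * (1 / fibre_density p X U x) + r * (1 / fibre_density q X U x)"
      using r fibre_density_pos[OF assms(1,3), of x p] fibre_density_pos[OF assms(1,3), of x q]
      by (intro three_le_if_prod_eq_one) (auto simp: field_simps power2_eq_square)
  qed
  also have "\<dots> = ?E / r\<^sup>2 + r * (\<Sum>x\<in>U. 1 / fibre_density p X U x)
        + r * (\<Sum>x\<in>U. 1 / fibre_density q X U x)"
    by (simp only: sum.distrib sum_distrib_left sum_divide_distrib)
  also have "\<dots> \<le> ?E / r\<^sup>2 + r * N + r * N"
    using r by (intro add_mono mult_left_mono)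
      (auto simp: N_def intro: sum_inverse_fibre_density_le[OF assms(1,3)])
  finally have "3 * real (card U) \<le> ?E / r\<^sup>2 + 2 * (r * N)" by (simp add: mult.commute)
  moreover have "card U = r * N" using N by (simp add: r_def)
  ultimately have "r * N \<le> ?E / r\<^sup>2" by linarith
  then have "r * N * r\<^sup>2 \<le> ?E" using r by (simp add: pos_le_divide_eq)
  then have "r ^ 3 * N \<le> ?E"
    by (simp add: power3_eq_cube power2_eq_square mult_ac)
  then show ?thesis by (simp add: r_def N_def)
qed simp

section \<open>Counting words coordinate by coordinate\<close>

lemma lists_of_length:
  shows finite_lists_of_length: "finite {xs :: 'l::finite list. length xs = n}"
    and lists_of_length_nonempty: "{xs :: 'l list. length xs = n} \<noteq> {}"
    and card_lists_of_length: "card {xs :: 'l list. length xs = n} = CARD('l) ^ n"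
  using finite_lists_length_eq[of "UNIV :: 'l set" n] card_lists_length_eq[of "UNIV :: 'l set" n]
  by (simp_all add: Ex_list_of_length)

lemma card_map_eq_Cons:
  fixes g :: "'l::finite \<Rightarrow> 'k"
  shows "card {ys. map g ys = z # zs} = card {y. g y = z} * card {ys. map g ys = zs}"
proof -
  have "{ys. map g ys = z # zs} = (\<lambda>(y, ys). y # ys) ` ({y. g y = z} \<times> {ys. map g ys = zs})"
    by (auto simp: map_eq_Cons_conv)
  then show ?thesis
    by (simp add: card_image inj_on_def card_cartesian_product)
qed

lemma finite_map_eq:
  fixes g :: "'l::finite \<Rightarrow> 'k"
  shows "finite {ys. map g ys = zs}"
  by (rule finite_subset[OF _ finite_lists_length_eq[of UNIV "length zs"]]) auto

lemma sum_length_Suc: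
  fixes F :: "'l::finite list \<Rightarrow> real"
  shows "(\<Sum>xs | length xs = Suc n. F xs) = (\<Sum>x\<in>UNIV. \<Sum>xs | length xs = n. F (x # xs))"
proof -
  have "{xs :: 'l list. length xs = Suc n} = (\<lambda>(x, xs). x # xs) ` (UNIV \<times> {xs. length xs = n})"
    by (auto simp: length_Suc_conv)
  then have "(\<Sum>xs | length xs = Suc n. F xs)
      = (\<Sum>(x, xs)\<in>UNIV \<times> {xs. length xs = n}. F (x # xs))"
    by (simp add: sum.reindex inj_on_def case_prod_beta)
  then show ?thesis by (simp add: sum.cartesian_product)
qed

text \<open>The pairs of resamplings of \<open>xs\<close>, one keeping \<open>p\<close> and one
  keeping \<open>q\<close> letterwise, that satisfy \<open>R\<close> in every coordinate. The
  sampling constraints and \<open>R\<close> are all coordinatewise, so the count is a product over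
  letters.\<close>

definition good_pairs ::
    "('l \<Rightarrow> 'k) \<Rightarrow> ('l \<Rightarrow> 'm) \<Rightarrow> ('l \<Rightarrow> 'l \<Rightarrow> 'l \<Rightarrow> bool) \<Rightarrow> 'l list \<Rightarrow> ('l list \<times> 'l list) set"
  where "good_pairs p q R xs = {(ys, zs). map p ys = map p xs \<and> map q zs = map q xs \<and>
           (\<forall>i<length xs. R (xs ! i) (ys ! i) (zs ! i))}"

lemma finite_good_pairs:
  fixes p :: "'l::finite \<Rightarrow> 'k" and q :: "'l \<Rightarrow> 'm"
  shows "finite (good_pairs p q R xs)"
  by (rule finite_subset[of _ "{ys. map p ys = map p xs} \<times> {zs. map q zs = map q xs}"])
     (auto simp: good_pairs_def finite_map_eq)

lemma card_good_pairs_Cons: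
  fixes p :: "'l::finite \<Rightarrow> 'k" and q :: "'l \<Rightarrow> 'm"
  shows "card (good_pairs p q R (x # xs))
       = card {(y, z). p y = p x \<and> q z = q x \<and> R x y z} * card (good_pairs p q R xs)"
proof -
  have "good_pairs p q R (x # xs) = (\<lambda>((y, z), (ys, zs)). (y # ys, z # zs)) `
      ({(y, z). p y = p x \<and> q z = q x \<and> R x y z} \<times> good_pairs p q R xs)"
    by (force simp: good_pairs_def map_eq_Cons_conv All_less_Suc2 image_iff)
  moreover have "inj (\<lambda>((y, z), (ys, zs)). (y # ys :: 'l list, z # zs :: 'l list))"
    by (auto simp: inj_on_def)
  ultimately show ?thesis
    by (simp only: card_image[OF inj_on_subset[OF _ subset_UNIV]] card_cartesian_product)
qed

text \<open>Independence of the coordinates: divided by the number of words, the left side is the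
  probability that \<open>R\<close> holds everywhere. Numerator and both denominators are
  multiplicative under \<open>Cons\<close>, so induction splits off one letter.\<close>

lemma sum_good_pairs:
  fixes p :: "'l::finite \<Rightarrow> 'k" and q :: "'l \<Rightarrow> 'm"
  shows "(\<Sum>xs | length xs = n. card (good_pairs p q R xs) /
             (real (card {ys. map p ys = map p xs}) * real (card {zs. map q zs = map q xs})))
       = (\<Sum>x\<in>UNIV. card {(y, z). p y = p x \<and> q z = q x \<and> R x y z} /
             (real (card {y. p y = p x}) * real (card {z. q z = q x}))) ^ n"
proof (induction n)
  case 0
  then show ?case by (simp add: good_pairs_def)
next
  case (Suc n)
  show ?case
    unfolding sum_length_Suc list.map card_map_eq_Cons card_good_pairs_Cons power_Suc
      Suc.IH[symmetric] sum_product
    by (intro sum.cong refl) simp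
qed

section \<open>Pairs of words agreeing on the positions of \<open>P1\<close>\<close>

text \<open>
  A letter \<open>x\<close> encodes a pair of players \<open>(fst x, other x)\<close> of which both or neither is \<open>P1\<close>; the
  pair \<open>(P1, P1)\<close> is encoded twice, which makes \<open>fst\<close> uniform.
\<close>

fun other :: "player \<times> bool \<Rightarrow> player" where
  "other (l, t) = (if l = P1 then P1 else if t then P2 else P3)"

lemma UNIV_player: "UNIV = {P1, P2, P3}"
  using player.exhaust by blast

lemma card_UNIV_player: "card (UNIV :: player set) = 3"
  by (simp add: UNIV_player)

text \<open>Each letter contributes a factor 2: \<open>P1\<close> has two codes but only itself in
  its class, while \<open>P2\<close> and \<open>P3\<close> share a class of size two and each pair
  of them has one code. Hence, for a uniform coded word, \<open>other\<close> is a resampling of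
  \<open>fst\<close> given the positions of \<open>P1\<close>.\<close>

lemma card_lifts:
  assumes "map (\<lambda>l. l = P1) v = map (\<lambda>l. l = P1) w"
  shows "card {xs. map fst xs = w \<and> map other xs = v} *
         card {u. map (\<lambda>l. l = P1) u = map (\<lambda>l. l = P1) w} = 2 ^ length w"
proof -
  have split: "{xs. map fst xs = w \<and> map other xs = v}
      = {xs. map (\<lambda>x. (fst x, other x)) xs = zip w v}" if "length v = length w" for v w
    using that by (auto simp: list_eq_iff_nth_eq)
  have "length v = length w" using assms by (metis length_map)
  then show ?thesis using assms
  proof (induction v w rule: list_induct2)
    case Nil
    then show ?case by simp
  next
    case (Cons m v l w)
    have "{x. (fst x, other x) = (l, m)} =
        (if l = P1 then {(P1, True), (P1, False)} else {(l, m = P2)})"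
      using Cons.prems by (cases l; cases m) (auto split: if_splits)
    moreover have "{u. (u = P1) = (l = P1)} = (if l = P1 then {P1} else {P2, P3})"
      by (cases l) (auto intro: player.exhaust)
    ultimately have "card {x. (fst x, other x) = (l, m)} * card {u. (u = P1) = (l = P1)} = 2"
      by auto
    moreover have "card {xs. map fst xs = l # w \<and> map other xs = m # v}
        = card {x. (fst x, other x) = (l, m)} * card {xs. map fst xs = w \<and> map other xs = v}"
      using Cons.hyps by (simp only: split length_Cons zip_Cons_Cons card_map_eq_Cons)
    moreover have "card {u. map (\<lambda>l. l = P1) u = map (\<lambda>l. l = P1) (l # w)}
        = card {u. (u = P1) = (l = P1)} * card {u. map (\<lambda>l. l = P1) u = map (\<lambda>l. l = P1) w}"
      by (simp only: list.map card_map_eq_Cons)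
    moreover have "card {xs. map fst xs = w \<and> map other xs = v} *
         card {u. map (\<lambda>l. l = P1) u = map (\<lambda>l. l = P1) w} = 2 ^ length w"
      using Cons.IH Cons.prems by simp
    ultimately show ?case
      by (metis (no_types, lifting) length_Cons mult.assoc mult.left_commute power_Suc)
  qed
qed

definition lift :: "nat \<Rightarrow> player list set \<Rightarrow> (player \<times> bool) list set" where
  "lift n W = {xs. length xs = n \<and> map fst xs \<in> W \<and> map other xs \<in> W}"

text \<open>This is Cauchy-Schwarz for the classes of words with the same positions of
  \<open>P1\<close>: two conditionally independent members of a class both lie in \<open>W\<close>
  with probability at least the square of the density of \<open>W\<close>.\<close>

lemma card_lift_ge:
  assumes "W \<subseteq> {w. length w = n}"
  shows "(card W / 3 ^ n)\<^sup>2 \<le> card (lift n W) / 6 ^ n"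
proof -
  let ?X = "{w :: player list. length w = n}"
  let ?s = "map (\<lambda>l. l = P1)"
  let ?A = "\<lambda>w v. {xs. map fst xs = w \<and> map other xs = v}"
  have finX: "finite ?X" and cardX: "card ?X = 3 ^ n"
    by (simp_all add: lists_of_length card_UNIV_player)
  have finW: "finite W" using assms finX finite_subset by blast
  have finA: "finite (?A w v)" for w v
    by (rule finite_subset[OF _ finite_map_eq[of fst w]]) auto
  have "lift n W = (\<Union>w\<in>W. \<Union>v\<in>W. ?A w v)"
    using assms by (auto simp: lift_def)
  then have "card (lift n W) = (\<Sum>w\<in>W. card (\<Union>v\<in>W. ?A w v))"
    using finW finA by (simp only:) (intro card_UN_disjoint; auto)
  also have "\<dots> = (\<Sum>w\<in>W. \<Sum>v\<in>W. card (?A w v))"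
    using finW finA by (intro sum.cong refl card_UN_disjoint; auto)
  finally have "real (card (lift n W)) = (\<Sum>w\<in>W. \<Sum>v\<in>W. real (card (?A w v)))" by simp
  also have "\<dots> \<ge> (\<Sum>w\<in>W. 2 ^ n * fibre_density ?s ?X W w)"
  proof (rule sum_mono)
    fix w assume w: "w \<in> W"
    then have lw: "length w = n" using assms by auto
    have fib: "{v \<in> ?X. ?s v = ?s w} = {v. ?s v = ?s w}"
      using lw by (auto dest: map_eq_imp_length_eq)
    have pos: "card {v. ?s v = ?s w} > 0"
      using finite_map_eq[of "\<lambda>l. l = P1" "?s w"] by (auto simp: card_gt_0_iff)
    have val: "real (card (?A w v)) = 2 ^ n / card {v. ?s v = ?s w}" if "?s v = ?s w" for v
      using card_lifts[OF that] pos lw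
      by (simp add: field_simps flip: of_nat_mult of_nat_power)
    \<comment> \<open>Only words \<open>v\<close> in the class of \<open>w\<close> are kept; by
      \<open>val\<close> each contributes the same number of lifts.\<close>
    have "2 ^ n * fibre_density ?s ?X W w = (\<Sum>v\<in>{v \<in> W. ?s v = ?s w}. real (card (?A w v)))"
      using fib by (simp add: val fibre_density_def)
    also have "\<dots> \<le> (\<Sum>v\<in>W. real (card (?A w v)))"
      using finW by (intro sum_mono2) auto
    finally show "2 ^ n * fibre_density ?s ?X W w \<le> (\<Sum>v\<in>W. real (card (?A w v)))" .
  qed
  finally have ge: "2 ^ n * (\<Sum>w\<in>W. fibre_density ?s ?X W w) \<le> card (lift n W)"
    by (simp add: sum_distrib_left)
  define r where "r = card W / 3 ^ n"
  have "r ^ 3 * 3 ^ n \<le> (\<Sum>w\<in>W. fibre_density ?s ?X W w * fibre_density (\<lambda>_. ()) ?X W w)"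
    \<comment> \<open>For a constant second map the second density is \<open>r\<close> everywhere,
      so one factor \<open>r\<close> of the cubic bound can be cancelled.\<close>
    using reflection_bound[OF finX lists_of_length_nonempty assms, of ?s "\<lambda>_. ()"]
    by (simp add: r_def cardX)
  also have "\<dots> = r * (\<Sum>w\<in>W. fibre_density ?s ?X W w)"
  proof -
    have "fibre_density (\<lambda>_. ()) ?X W w = r" for w
      using cardX by (simp add: fibre_density_def r_def)
    then show ?thesis by (simp add: sum_distrib_left mult.commute)
  qed
  finally have main: "r ^ 3 * 3 ^ n \<le> r * (\<Sum>w\<in>W. fibre_density ?s ?X W w)" .
  have "r\<^sup>2 * 3 ^ n \<le> (\<Sum>w\<in>W. fibre_density ?s ?X W w)"
  proof (cases "r = 0")
    case True
    then show ?thesis by (simp add: sum_nonneg fibre_density_def)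
  next
    case False
    then have "r > 0" by (simp add: r_def)
    then show ?thesis using main by (simp add: power3_eq_cube power2_eq_square mult.assoc)
  qed
  then have "2 ^ n * (r\<^sup>2 * 3 ^ n) \<le> card (lift n W)"
    using ge by (meson mult_left_mono order_trans zero_le_numeral zero_le_power)
  moreover have "(6::real) ^ n = 2 ^ n * 3 ^ n" by (simp flip: power_mult_distrib)
  ultimately show ?thesis by (simp add: r_def field_simps)
qed

section \<open>The two resamplings and the cycle in one coordinate\<close>

text \<open>This resampling keeps the questions of player 2 in the second word and of player 3 in
  the first.\<close>

definition left_key :: "player \<times> bool \<Rightarrow> bool \<times> bool" where
  "left_key x = (other x = P2, fst x = P3)"

text \<open>This resampling keeps the questions of player 2 in both words.\<close>

definition right_key :: "player \<times> bool \<Rightarrow> bool \<times> bool" where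
  "right_key x = (other x = P2, fst x = P2)"

definition no_cycle :: "player \<times> bool \<Rightarrow> player \<times> bool \<Rightarrow> player \<times> bool \<Rightarrow> bool" where
  "no_cycle x y z \<longleftrightarrow> \<not> (fst x = P1 \<and> fst y \<noteq> P1 \<and> fst z \<noteq> P1)"

lemma all_player: "(\<forall>l. P l) \<longleftrightarrow> P P1 \<and> P P2 \<and> P P3"
  by (metis player.exhaust)

text \<open>Each of the six letters contributes at most 1. Each of the two codes of
  \<open>(P1, P1)\<close> has fibres of size 3 under both keys, and exactly one of the 9 pairs
  closes the cycle. The total is at most \<open>4 + 2 * 8 / 9 = 52 / 9\<close>.\<close>

lemma local_no_cycle_sum:
  "(\<Sum>x\<in>UNIV.
      card {(y, z). left_key y = left_key x \<and> right_key z = right_key x \<and> no_cycle x y z} /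
      (real (card {y. left_key y = left_key x}) * real (card {z. right_key z = right_key x})))
   \<le> 52 / 9" (is "(\<Sum>x\<in>UNIV. ?g x) \<le> _")
proof -
  have le1: "?g x \<le> 1" for x
  proof -
    have "card {(y, z). left_key y = left_key x \<and> right_key z = right_key x \<and> no_cycle x y z}
       \<le> card ({y. left_key y = left_key x} \<times> {z. right_key z = right_key x})"
      by (intro card_mono) auto
    then have "real (card {(y, z). left_key y = left_key x \<and> right_key z = right_key x \<and>
        no_cycle x y z}) \<le> real (card {y. left_key y = left_key x}) *
          real (card {z. right_key z = right_key x})"
      by (simp only: card_cartesian_product of_nat_mult[symmetric] of_nat_le_iff)
    then show ?thesis
      by (intro divide_le_eq_1[THEN iffD2]) (auto simp: less_le)
  qed
  have eq: "?g (P1, t) = 8 / 9" for t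
  proof -
    have L: "{y. left_key y = left_key (P1, t)} = {(P1, False), (P1, True), (P2, False)}"
      by (cases t) (simp_all add: set_eq_iff all_player all_bool_eq left_key_def)
    have R: "{z. right_key z = right_key (P1, t)} = {(P1, False), (P1, True), (P3, False)}"
      by (cases t) (simp_all add: set_eq_iff all_player all_bool_eq right_key_def)
    have "{(y, z). left_key y = left_key (P1, t) \<and> right_key z = right_key (P1, t) \<and>
             no_cycle (P1, t) y z}
        = {y. left_key y = left_key (P1, t)} \<times> {z. right_key z = right_key (P1, t)}
            - {((P2, False), (P3, False))}"
      by (cases t) (simp_all add: set_eq_iff all_player all_bool_eq no_cycle_def left_key_def right_key_def)
    then show ?thesis
      unfolding L R by (simp add: L R card_Diff_subset card_cartesian_product)
  qed
  have "(\<Sum>x\<in>UNIV. ?g x) = (\<Sum>l\<in>UNIV. \<Sum>t\<in>UNIV. ?g (l, t))"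
    unfolding sum.cartesian_product UNIV_Times_UNIV
    by (intro sum.cong refl) (simp add: case_prod_beta)
  also have "\<dots> = (\<Sum>t\<in>UNIV. ?g (P1, t)) + (\<Sum>t\<in>UNIV. ?g (P2, t)) + (\<Sum>t\<in>UNIV. ?g (P3, t))"
    by (simp add: UNIV_player)
  also have "\<dots> \<le> (\<Sum>t\<in>(UNIV::bool set). 8 / 9) + (\<Sum>t\<in>(UNIV::bool set). 1) + (\<Sum>t\<in>(UNIV::bool set). 1)"
    by (intro add_mono sum_mono le1 order.eq_iff[THEN iffD1, THEN conjunct1] eq)
  finally show ?thesis by simp
qed

section \<open>Winning words and the parity obstruction\<close>

definition question :: "player \<Rightarrow> player \<Rightarrow> nat" where
  "question j l = (if l = j then 0 else 1)"

definition winning_words :: "nat \<Rightarrow> (player \<Rightarrow> nat list \<Rightarrow> nat list) \<Rightarrow> player list set" where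
  "winning_words n f = {w. length w = n \<and> (\<forall>i<n. pred anti_correlation
     (\<lambda>j. question j (w ! i)) (\<lambda>j. f j (map (question j) w) ! i))}"

lemma winning_wordsD:
  assumes "w \<in> winning_words n f" "i < n"
  shows "w ! i = P1 \<Longrightarrow> f P2 (map (question P2) w) ! i + f P3 (map (question P3) w) ! i = 1"
    and "w ! i = P2 \<Longrightarrow> f P1 (map (question P1) w) ! i + f P3 (map (question P3) w) ! i = 1"
    and "w ! i = P3 \<Longrightarrow> f P1 (map (question P1) w) ! i + f P2 (map (question P2) w) ! i = 1"
  using assms by (auto simp: winning_words_def anti_correlation_def question_def)

text \<open>
  If \<open>no_cycle\<close> failed at \<open>i\<close>, then the answers of player 2 to \<open>map other xs\<close>, player 1 to \<open>ys\<close>,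
  player 3 to \<open>map fst xs\<close>, player 2 to \<open>map fst xs\<close> and player 1 to \<open>zs\<close> would alternate at \<open>i\<close>
  around a cycle of length 5.
\<close>

lemma winning_no_cycle:
  assumes x: "xs \<in> lift n (winning_words n f)" and y: "ys \<in> lift n (winning_words n f)"
    and z: "zs \<in> lift n (winning_words n f)"
    and l: "map left_key ys = map left_key xs" and r: "map right_key zs = map right_key xs"
    and i: "i < n"
  shows "no_cycle (xs ! i) (ys ! i) (zs ! i)"
proof (rule ccontr)
  assume "\<not> no_cycle (xs ! i) (ys ! i) (zs ! i)"
  then have fx: "fst (xs ! i) = P1" and fy: "fst (ys ! i) \<noteq> P1" and fz: "fst (zs ! i) \<noteq> P1"
    by (auto simp: no_cycle_def)
  have len: "length xs = n" "length ys = n" "length zs = n"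
    using x y z by (auto simp: lift_def)
  have lk: "left_key (ys ! k) = left_key (xs ! k)" and rk: "right_key (zs ! k) = right_key (xs ! k)"
    if "k < n" for k
    using l r that len by (metis nth_map)+
  have ox: "other (xs ! i) = P1" using fx by (cases "xs ! i") auto
  \<comment> \<open>At \<open>i\<close> the left key excludes \<open>P3\<close> as first and
    \<open>P2\<close> as second component, so apart from \<open>(P1, P1)\<close> only
    \<open>(P2, P3)\<close> is possible. In the same way the right key forces
    \<open>(P3, P3)\<close> for \<open>zs\<close>.\<close>
  have y2: "fst (ys ! i) = P2" "other (ys ! i) = P3"
    using lk[OF i] fx fy ox player.exhaust[of "fst (ys ! i)"]
    by (cases "ys ! i"; force simp: left_key_def split: if_splits)+
  have z3: "fst (zs ! i) = P3" "other (zs ! i) = P3"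
    using rk[OF i] fx fz ox player.exhaust[of "fst (zs ! i)"]
    by (cases "zs ! i"; force simp: right_key_def split: if_splits)+
  \<comment> \<open>The two words of a pair agree on the positions of \<open>P1\<close>, so player 1
    gives a single answer list for both; this links two edges of the cycle at \<open>ys\<close> and
    two at \<open>zs\<close>.\<close>
  have v1: "map (question P1) (map other us) = map (question P1) (map fst us)"
    for us :: "(player \<times> bool) list"
    by (auto simp: question_def split: if_split_asm)
  have v2y: "map (question P2) (map other ys) = map (question P2) (map other xs)"
    and v3: "map (question P3) (map fst ys) = map (question P3) (map fst xs)"
    using lk len by (auto simp: list_eq_iff_nth_eq question_def left_key_def)
  have v2z: "map (question P2) (map other zs) = map (question P2) (map other xs)"
    and v2: "map (question P2) (map fst zs) = map (question P2) (map fst xs)"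
    using rk len by (auto simp: list_eq_iff_nth_eq question_def right_key_def)
  let ?a = "\<lambda>j w. f j (map (question j) w) ! i"
  have "?a P2 (map fst xs) + ?a P3 (map fst xs) = 1"
    using winning_wordsD(1)[of "map fst xs" n f i] x fx i len by (simp add: lift_def)
  moreover have "?a P1 (map fst ys) + ?a P3 (map fst ys) = 1"
    using winning_wordsD(2)[of "map fst ys" n f i] y y2 i len by (simp add: lift_def)
  moreover have "?a P1 (map other ys) + ?a P2 (map other ys) = 1"
    using winning_wordsD(3)[of "map other ys" n f i] y y2 i len by (simp add: lift_def)
  moreover have "?a P1 (map fst zs) + ?a P2 (map fst zs) = 1"
    using winning_wordsD(3)[of "map fst zs" n f i] z z3 i len by (simp add: lift_def)
  moreover have "?a P1 (map other zs) + ?a P2 (map other zs) = 1"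
    using winning_wordsD(3)[of "map other zs" n f i] z z3 i len by (simp add: lift_def)
  \<comment> \<open>Each of the five bits occurs in exactly two equations, so adding them all
    equates an even number with 5.\<close>
  moreover have False if "a + b = 1" "c + b = 1" "c + d = 1" "e + a = 1" "e + d = 1"
    for a b c d e :: nat
    using that by presburger
  ultimately show False
    unfolding v1 v2y v2z v2 v3 by blast
qed

text \<open>The exponent 6 is 2 times 3: passing to pairs of words squares the density, and the two
  resamplings cube it. The upper bound is the probability that no coordinate closes a cycle.\<close>

lemma card_winning_words_le:
  "(card (winning_words n f) / 3 ^ n) ^ 6 \<le> (26 / 27) ^ n"
proof -
  let ?W = "winning_words n f"
  let ?X = "{xs :: (player \<times> bool) list. length xs = n}"
  let ?U = "lift n ?W"
  let ?D = "\<lambda>xs. real (card {ys. map left_key ys = map left_key xs}) *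
                   real (card {zs. map right_key zs = map right_key xs})"
  let ?N = "\<lambda>xs. card (good_pairs left_key right_key no_cycle xs)"
  have c6: "card (UNIV :: (player \<times> bool) set) = 6"
    by (simp add: card_UNIV_player flip: UNIV_Times_UNIV)
  have finX: "finite ?X" and cardX: "card ?X = 6 ^ n"
    by (simp_all only: lists_of_length c6)
  have UX: "?U \<subseteq> ?X" by (auto simp: lift_def)
  define u where "u = card ?U / 6 ^ n"
  have fibX: "{ys \<in> ?X. map p ys = map p xs} = {ys. map p ys = map p xs}"
    if "xs \<in> ?X" for p :: "player \<times> bool \<Rightarrow> bool \<times> bool" and xs
    using that by (auto dest: map_eq_imp_length_eq)
  have "u ^ 3 * 6 ^ n \<le>
      (\<Sum>xs\<in>?U. fibre_density (map left_key) ?X ?U xs * fibre_density (map right_key) ?X ?U xs)"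
    using reflection_bound[OF finX lists_of_length_nonempty UX, of "map left_key" "map right_key"]
    by (simp add: u_def cardX)
  also have "\<dots> \<le> (\<Sum>xs\<in>?U. ?N xs / ?D xs)"
  proof (rule sum_mono)
    fix xs assume xs: "xs \<in> ?U"
    let ?L = "{ys \<in> ?U. map left_key ys = map left_key xs}"
    let ?R = "{zs \<in> ?U. map right_key zs = map right_key xs}"
    \<comment> \<open>Two resamplings that both stay in the lifted winning set avoid the cycle in
      every coordinate, so the numerators of the two densities count only good pairs.\<close>
    have "?L \<times> ?R \<subseteq> good_pairs left_key right_key no_cycle xs"
      using xs winning_no_cycle[OF xs] by (auto simp: good_pairs_def lift_def)
    then have "card ?L * card ?R \<le> ?N xs"
      unfolding card_cartesian_product[symmetric] by (rule card_mono[OF finite_good_pairs])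
    then have "real (card ?L) * real (card ?R) \<le> real (?N xs)"
      by (simp only: of_nat_mult[symmetric] of_nat_le_iff)
    moreover have "xs \<in> ?X" using xs UX by blast
    ultimately show "fibre_density (map left_key) ?X ?U xs * fibre_density (map right_key) ?X ?U xs
        \<le> ?N xs / ?D xs"
      unfolding fibre_density_def fibX[OF \<open>xs \<in> ?X\<close>] by (simp add: divide_right_mono)
  qed
  also have "\<dots> \<le> (\<Sum>xs\<in>?X. ?N xs / ?D xs)"
    using finX UX by (intro sum_mono2) auto
  also have "\<dots> \<le> (52 / 9) ^ n"
    unfolding sum_good_pairs
    by (intro power_mono local_no_cycle_sum sum_nonneg) auto
  \<comment> \<open>Averaging the local sum over the 6 letters gives \<open>26 / 27\<close>, the
    bound per coordinate.\<close>
  also have "(52 / 9 :: real) ^ n = (26 / 27) ^ n * 6 ^ n"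
    by (simp flip: power_mult_distrib)
  finally have u3: "u ^ 3 \<le> (26 / 27) ^ n" by simp
  have "(card ?W / 3 ^ n)\<^sup>2 \<le> u"
    unfolding u_def by (rule card_lift_ge) (auto simp: winning_words_def)
  then have "((card ?W / 3 ^ n)\<^sup>2) ^ 3 \<le> u ^ 3"
    by (intro power_mono) auto
  with u3 show ?thesis by (simp flip: power_mult)
qed

section \<open>From counting words to the value of the repeated game\<close>

lemma replicate_pmf_map: "replicate_pmf n (map_pmf h p) = map_pmf (map h) (replicate_pmf n p)"
  by (induction n) (simp_all add: map_pmf_def bind_assoc_pmf bind_return_pmf)

lemma pair_pmf_of_set:
  assumes "finite A" "A \<noteq> {}" "finite B" "B \<noteq> {}"
  shows "pair_pmf (pmf_of_set A) (pmf_of_set B) = pmf_of_set (A \<times> B)"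
proof (rule pmf_eqI)
  fix x :: "'a \<times> 'b"
  show "pmf (pair_pmf (pmf_of_set A) (pmf_of_set B)) x = pmf (pmf_of_set (A \<times> B)) x"
    using assms by (cases x) (simp add: pmf_pair indicator_def card_cartesian_product)
qed

lemma replicate_pmf_uniform:
  "replicate_pmf n (pmf_of_set (UNIV :: 'l::finite set)) = pmf_of_set {xs. length xs = n}"
proof (induction n)
  case 0
  then show ?case by (simp add: pmf_of_set_singleton)
next
  case (Suc n)
  let ?X = "{xs :: 'l list. length xs = n}"
  have X: "finite ?X" "?X \<noteq> {}"
    by (fact lists_of_length)+
  have "replicate_pmf (Suc n) (pmf_of_set (UNIV :: 'l set))
      = map_pmf (\<lambda>(x, xs). x # xs) (pair_pmf (pmf_of_set UNIV) (pmf_of_set ?X))"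
    by (simp add: Suc.IH pair_pmf_def map_pmf_def bind_assoc_pmf bind_return_pmf)
  also have "\<dots> = map_pmf (\<lambda>(x, xs). x # xs) (pmf_of_set (UNIV \<times> ?X))"
    using X by (simp add: pair_pmf_of_set)
  also have "\<dots> = pmf_of_set ((\<lambda>(x, xs). x # xs) ` (UNIV \<times> ?X))"
    using X by (intro map_pmf_of_set_inj) (auto simp: inj_on_def)
  also have "(\<lambda>(x, xs). x # xs) ` (UNIV \<times> ?X) = {xs :: 'l list. length xs = Suc n}"
    by (auto simp: length_Suc_conv)
  finally show ?case .
qed

lemma distr_anti_correlation:
  "distr anti_correlation = map_pmf (\<lambda>l j. question j l) (pmf_of_set UNIV)"
proof -
  have "inj (\<lambda>l j. question j l)"
    by (auto simp: inj_def question_def fun_eq_iff split: if_splits)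
  moreover have "(\<lambda>j. question j P1) = case_player 0 1 1"
      "(\<lambda>j. question j P2) = case_player 1 0 1"
      "(\<lambda>j. question j P3) = case_player 1 1 0"
    by (auto simp: fun_eq_iff question_def split: player.split)
  then have "{case_player 0 1 1, case_player 1 0 1, case_player 1 1 0}
      = range (\<lambda>l j. question j l)"
    by (simp add: UNIV_player)
  ultimately show ?thesis
    by (simp add: anti_correlation_def map_pmf_of_set_inj)
qed

text \<open>The questions are the image of a uniform player under \<open>question\<close>; pushing
  this map through the independent sampling turns the question lists into images of a uniform word
  among the \<open>3 ^ n\<close>.\<close>

lemma win_prob_parallel_repetition:
  "win_prob (parallel_repetition n anti_correlation) f = card (winning_words n f) / 3 ^ n"
proof -
  let ?X = "{w :: player list. length w = n}"
  have X: "finite ?X" "?X \<noteq> {}" "card ?X = 3 ^ n"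
    by (simp_all only: lists_of_length card_UNIV_player not_False_eq_True)
  have "win_prob (parallel_repetition n anti_correlation) f = measure_pmf.prob (pmf_of_set ?X)
      {w. \<forall>i<n. pred anti_correlation (\<lambda>j. map (question j) w ! i)
              (\<lambda>j. f j (map (question j) w) ! i)}"
    by (simp add: win_prob_def parallel_repetition_def distr_anti_correlation replicate_pmf_map
          replicate_pmf_uniform pmf.map_comp measure_map_pmf vimage_def o_def)
  also have "\<dots> = card (?X \<inter> {w. \<forall>i<n. pred anti_correlation (\<lambda>j. map (question j) w ! i)
              (\<lambda>j. f j (map (question j) w) ! i)}) / 3 ^ n"
    using X by (simp add: measure_pmf_of_set)
  also have "?X \<inter> {w. \<forall>i<n. pred anti_correlation (\<lambda>j. map (question j) w ! i)
              (\<lambda>j. f j (map (question j) w) ! i)} = winning_words n f"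
    by (auto simp: winning_words_def)
  finally show ?thesis .
qed

theorem theorem4p2:
  shows "\<exists>c::real. c > 0 \<and>
           (\<forall>n::nat. val (parallel_repetition n anti_correlation) \<le> exp (- c * real n))"
proof (intro exI conjI allI)
  \<comment> \<open>Chosen so that the sixth power of \<open>exp (- ?c)\<close> is
    \<open>26 / 27\<close>.\<close>
  let ?c = "ln (27 / 26) / 6 :: real"
  show "?c > 0" by simp
  fix n
  let ?G = "parallel_repetition n anti_correlation"
  have "exp (- ?c * real n) ^ 6 = exp (- ln (27 / 26)) ^ n"
    by (simp flip: exp_of_nat_mult add: mult_ac)
  also have "\<dots> = (26 / 27) ^ n" by (simp add: exp_minus)
  finally have "exp (- ?c * real n) ^ 6 = (26 / 27) ^ n" .
  then have "win_prob ?G f ^ 6 \<le> exp (- ?c * real n) ^ 6" for f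
    using card_winning_words_le[of n f] by (simp add: win_prob_parallel_repetition)
  then have "win_prob ?G f \<le> exp (- ?c * real n)" for f
    by (rule power_mono_iff[THEN iffD1, rotated -1]) (auto simp: win_prob_def)
  then show "val ?G \<le> exp (- ?c * real n)"
    \<comment> \<open>The bound holds for every \<open>f\<close>; finiteness and nonemptiness of the
      strategy set carry it over to the \<open>Max\<close>.\<close>
    using strategies_finite_nonempty[OF wf_game_parallel_repetition[OF wf_game_anti_correlation]]
    by (simp add: val_def)
qed

end
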